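(* Consider the autonomous system on $\mathbb{R}^5$ with real parameters $C,D,E,F$ $$ \begin{aligned} \dot y_1 &= Cy_1-\big[y_3+\tfrac18(y_1^2+y_2^2+y_4^2+y_5^2)\big]y_2-\tfrac34(y_1y_5-y_2y_4)y_4+2y_2,\\ \dot y_2 &= Cy_2+\big[y_3+\tfrac18(y_1^2+y_2^2+y_4^2+y_5^2)\big]y_1-\tfrac34(y_1y_5-y_2y_4)y_5+2y_1,\\ \dot y_3 &= D(y_1y_2+y_4y_5)+Ey_3+F,\\ \dot y_4 &= Cy_4-\big[y_3+\tfrac18(y_1^2+y_2^2+y_4^2+y_5^2)\big]y_5+\tfrac34(y_1y_5-y_2y_4)y_1+2y_5,\\ \dot y_5 &= Cy_5+\big[y_3+\tfrac18(y_1^2+y_2^2+y_4^2+y_5^2)\big]y_4+\tfrac34(y_1y_5-y_2y_4)y_2+2y_4. \end{aligned} $$ Let $L$ be a limit set of this system, let $\mathbf{y}_0=(y_{10},y_{20},y_{30},y_{40},y_{50})\in L$ with $y_{10}\neq0$ and $y_{20}\neq0$, and let $(y_1(t),\dots,y_5(t))$ be the solution starting from $\mathbf{y}_0$ at $t=0$. Then $\dfrac{y_{40}}{y_{10}}=\dfrac{y_{50}}{y_{20}}$, and, denoting this common value by $K$, the solution satisfies $$ \begin{aligned} \dot y_1 &= C y_1-\big[y_3+\tfrac18(1+K^2)(y_1^2+y_2^2)\big]y_2+2y_2,\\ \dot y_2 &= C y_2+\big[y_3+\tfrac18(1+K^2)(y_1^2+y_2^2)\big]y_1+2y_1,\\ \dot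 y_3 &= D(1+K^2)y_1y_2+Ey_3+F,\\ y_4 &= K y_1,\\ y_5 &= K y_2, \end{aligned} $$ so that the dynamics on the limit set is governed by a system of differential equations of third order with the additional parameter $K$.
   Context: The system is the averaged model of a spherical pendulum driven by a limited-power electric motor; $C,D,E,F$ are parameters determined by physical and geometric characteristics of the pendulum and the motor ($C$ is a damping parameter). The dot denotes $d/dt$. "Limit set" is understood in the standard sense of the $\omega$-limit set of a solution: for a solution $\mathbf{y}(t)$, $t\ge 0$, it is the set of all points $\mathbf{p}\in\mathbb{R}^5$ such that $\mathbf{y}(t_n)\to\mathbf{p}$ for some sequence $t_n\to+\infty$.
   Formalization: The formal theorem assumes C ≠ 0; for C = 0 the claim fails, e.g. with E = F = 0 the equilibrium (4/5, 32/15, 20/9, 16/15, −8/5) is a limit set with y4/y1 = 4/3 but y5/y2 = −3/4. *)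

theory Defs
  imports "HOL-Analysis.Analysis"
begin

definition pendulum_field :: "real \<Rightarrow> real \<Rightarrow> real \<Rightarrow> real \<Rightarrow> real^5 \<Rightarrow> real^5" where
  "pendulum_field C D E F y = vector [
     C * y$1 - (y$3 + 1/8 * ((y$1)\<^sup>2 + (y$2)\<^sup>2 + (y$4)\<^sup>2 + (y$5)\<^sup>2)) * y$2
       - 3/4 * (y$1 * y$5 - y$2 * y$4) * y$4 + 2 * y$2,
     C * y$2 + (y$3 + 1/8 * ((y$1)\<^sup>2 + (y$2)\<^sup>2 + (y$4)\<^sup>2 + (y$5)\<^sup>2)) * y$1
       - 3/4 * (y$1 * y$5 - y$2 * y$4) * y$5 + 2 * y$1,
     D * (y$1 * y$2 + y$4 * y$5) + E * y$3 + F,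
     C * y$4 - (y$3 + 1/8 * ((y$1)\<^sup>2 + (y$2)\<^sup>2 + (y$4)\<^sup>2 + (y$5)\<^sup>2)) * y$5
       + 3/4 * (y$1 * y$5 - y$2 * y$4) * y$1 + 2 * y$5,
     C * y$5 + (y$3 + 1/8 * ((y$1)\<^sup>2 + (y$2)\<^sup>2 + (y$4)\<^sup>2 + (y$5)\<^sup>2)) * y$4
       + 3/4 * (y$1 * y$5 - y$2 * y$4) * y$2 + 2 * y$4]"

text \<open>In the index type \<open>5\<close> arithmetic is modulo 5, so \<open>y$5\<close> is the same component as
  \<open>y$0\<close>; the indices 1 to 5 are pairwise distinct.\<close>

lemma vector_5 [simp]:
  "(vector [a, b, c, d, e] :: real^5) $ 1 = a"
  "(vector [a, b, c, d, e] :: real^5) $ 2 = b"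
  "(vector [a, b, c, d, e] :: real^5) $ 3 = c"
  "(vector [a, b, c, d, e] :: real^5) $ 4 = d"
  "(vector [a, b, c, d, e] :: real^5) $ 5 = e"
  unfolding vector_def by simp_all

text \<open>At endpoints of \<open>I\<close> that belong to \<open>I\<close> the derivative is one-sided.\<close>

definition pendulum_solution ::
  "real \<Rightarrow> real \<Rightarrow> real \<Rightarrow> real \<Rightarrow> real set \<Rightarrow> (real \<Rightarrow> real^5) \<Rightarrow> bool" where
  "pendulum_solution C D E F I y \<longleftrightarrow>
     (\<forall>t\<in>I. (y has_vector_derivative pendulum_field C D E F (y t)) (at t within I))"

definition omega_limit_set :: "(real \<Rightarrow> 'a::topological_space) \<Rightarrow> 'a set" where
  "omega_limit_set y =
     {p. \<exists>s :: nat \<Rightarrow> real. filterlim s at_top sequentially \<and> (\<lambda>n. y (s n)) \<longlonglongrightarrow> p}"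

definition pendulum_limit_set ::
  "real \<Rightarrow> real \<Rightarrow> real \<Rightarrow> real \<Rightarrow> (real^5) set \<Rightarrow> bool" where
  "pendulum_limit_set C D E F L \<longleftrightarrow>
     (\<exists>x. pendulum_solution C D E F {0..} x \<and> L = omega_limit_set x)"

end

theory Submission
  imports Defs
begin

text \<open>The two pairs \<open>(y\<^sub>1, y\<^sub>2)\<close> and \<open>(y\<^sub>4, y\<^sub>5)\<close> are plane vectors, and everything rests on their
  determinant \<open>\<Delta> = y\<^sub>1 y\<^sub>5 - y\<^sub>2 y\<^sub>4\<close>.  All nonlinear terms cancel in its derivative, which leaves
  \<open>\<Delta>' = 2 C \<Delta>\<close> (\<open>plane_det_derivative\<close>), so \<open>\<Delta>(t) = \<Delta>(0) exp (2 C t)\<close>.  For \<open>C < 0\<close> the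
  determinant tends to 0 along every solution; for \<open>C > 0\<close> it is unbounded unless it vanishes
  identically, and a solution with a limit point cannot have it unbounded along the corresponding
  sequence of times.  Either way \<open>\<Delta> = 0\<close> at every limit point (\<open>plane_det_limit_point\<close>), hence all
  along the solution through it.

  Once \<open>\<Delta> = 0\<close>, both pairs solve the same linear system with time-dependent coefficients
  \<open>u' = C u + (2 - A) v\<close>, \<open>v' = C v + (2 + A) u\<close>, where
  \<open>A = y\<^sub>3 + (y\<^sub>1\<^sup>2 + y\<^sub>2\<^sup>2 + y\<^sub>4\<^sup>2 + y\<^sub>5\<^sup>2) / 8\<close>.  So does their difference
  \<open>(y\<^sub>4 - K y\<^sub>1, y\<^sub>5 - K y\<^sub>2)\<close>, which starts at 0 and therefore stays there.  Uniqueness needs no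
  bound on \<open>A\<close>, since \<open>A\<close> drops out of the derivative of \<open>u\<^sup>2 + v\<^sup>2\<close>
  (\<open>linear_pair_zero\<close>).  Substituting \<open>y\<^sub>4 = K y\<^sub>1\<close> and \<open>y\<^sub>5 = K y\<^sub>2\<close> gives the reduced system.\<close>

section \<open>Vanishing of solutions of linear equations on an interval\<close>

lemma exp_weighted_mvt:
  fixes h h' :: "real \<Rightarrow> real" and c a b :: real
  assumes "a < b"
    and deriv: "\<And>s. s \<in> {a..b} \<Longrightarrow> (h has_real_derivative h' s) (at s within {a..b})"
  obtains x where "x \<in> {a<..<b}"
    "exp (c * b) * h b - exp (c * a) * h a = exp (c * x) * (h' x + c * h x) * (b - a)"
proof -
  have d: "((\<lambda>s. exp (c * s) * h s) has_derivative (*) (exp (c * s) * (h' s + c * h s)))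
      (at s within {a..b})" if "a \<le> s" "s \<le> b" for s
    using that unfolding has_field_derivative_def [symmetric]
    by (auto intro!: derivative_eq_intros deriv simp: algebra_simps)
  obtain x where "x \<in> {a<..<b}"
    "exp (c * b) * h b - exp (c * a) * h a = exp (c * x) * (h' x + c * h x) * (b - a)"
    using mvt_simple [OF \<open>a < b\<close> d] by auto
  then show thesis by (rule that)
qed

text \<open>A two-sided form of Gronwall's inequality with zero initial value: \<open>exp (- k t) h\<close> does not
  increase to the right of \<open>a\<close>, and \<open>exp (k t) h\<close> does not decrease to the left of it.\<close>

lemma nonneg_zero_if_derivative_bounded:
  fixes h h' :: "real \<Rightarrow> real" and k a t :: real
  assumes int: "is_interval I" and "a \<in> I" "t \<in> I"
    and deriv: "\<And>s. s \<in> I \<Longrightarrow> (h has_real_derivative h' s) (at s within I)"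
    and nonneg: "\<And>s. s \<in> I \<Longrightarrow> 0 \<le> h s"
    and bound: "\<And>s. s \<in> I \<Longrightarrow> \<bar>h' s\<bar> \<le> k * h s"
    and "h a = 0"
  shows "h t = 0"
proof -
  have sub: "{p..q} \<subseteq> I" if "p \<in> I" "q \<in> I" for p q
    using mem_is_interval_1_I [OF int that] by auto
  have deriv': "(h has_real_derivative h' s) (at s within {p..q})"
    if "p \<in> I" "q \<in> I" "s \<in> {p..q}" for p q s
    by (rule DERIV_subset [OF deriv sub]) (use sub that in blast)+
  have "h t \<le> 0"
  proof (cases rule: linorder_cases [of a t])
    case less
    obtain x where x: "x \<in> {a<..<t}"
      "exp (- k * t) * h t - exp (- k * a) * h a = exp (- k * x) * (h' x + - k * h x) * (t - a)"
      by (rule exp_weighted_mvt [OF less deriv' [OF \<open>a \<in> I\<close> \<open>t \<in> I\<close>]])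
    then have "x \<in> I" using sub [of a t] assms by auto
    then have "h' x + - k * h x \<le> 0" using bound [of x] by auto
    then have "exp (- k * x) * (h' x + - k * h x) * (t - a) \<le> 0"
      using less by (intro mult_nonpos_nonneg mult_nonneg_nonpos) auto
    then show ?thesis unfolding x(2) [symmetric] using \<open>h a = 0\<close> by (simp add: mult_le_0_iff)
  next
    case greater
    obtain x where x: "x \<in> {t<..<a}"
      "exp (k * a) * h a - exp (k * t) * h t = exp (k * x) * (h' x + k * h x) * (a - t)"
      by (rule exp_weighted_mvt [OF greater deriv' [OF \<open>t \<in> I\<close> \<open>a \<in> I\<close>]])
    then have "x \<in> I" using sub [of t a] assms by auto
    then have "0 \<le> h' x + k * h x" using bound [of x] by auto
    then have "0 \<le> exp (k * x) * (h' x + k * h x) * (a - t)"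
      using greater by simp
    then show ?thesis unfolding x(2) [symmetric] using \<open>h a = 0\<close> by (simp add: mult_le_0_iff)
  qed (use \<open>h a = 0\<close> in auto)
  with nonneg [OF \<open>t \<in> I\<close>] show ?thesis by simp
qed

text \<open>The coefficient \<open>A\<close> is an arbitrary function: with \<open>N = u\<^sup>2 + v\<^sup>2\<close> one has
  \<open>N' = 2 C N + 8 u v\<close>, and \<open>2 \<bar>u v\<bar> \<le> N\<close>.\<close>

lemma linear_pair_zero:
  fixes u v A :: "real \<Rightarrow> real" and C a t :: real
  assumes "is_interval I" "a \<in> I" "t \<in> I"
    and u: "\<And>s. s \<in> I \<Longrightarrow> (u has_real_derivative C * u s + (2 - A s) * v s) (at s within I)"
    and v: "\<And>s. s \<in> I \<Longrightarrow> (v has_real_derivative C * v s + (2 + A s) * u s) (at s within I)"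
    and "u a = 0" "v a = 0"
  shows "u t = 0" "v t = 0"
proof -
  let ?N = "\<lambda>s. (u s)\<^sup>2 + (v s)\<^sup>2"
  have "?N t = 0"
  proof (rule nonneg_zero_if_derivative_bounded [OF assms(1-3)])
    fix s assume s: "s \<in> I"
    show "(?N has_real_derivative 2 * C * ?N s + 8 * (u s * v s)) (at s within I)"
      by (rule derivative_eq_intros u v s refl | simp)+ (simp add: algebra_simps power2_eq_square)
    have "\<bar>2 * C * n + 8 * w\<bar> \<le> (2 * \<bar>C\<bar> + 4) * n" if "2 * \<bar>w\<bar> \<le> n" for n w :: real
    proof -
      have "\<bar>2 * C * n + 8 * w\<bar> \<le> 2 * \<bar>C\<bar> * n + 8 * \<bar>w\<bar>"
        using that by (intro order_trans [OF abs_triangle_ineq]) (simp add: abs_mult)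
      then show ?thesis using that by (simp add: distrib_right)
    qed
    moreover have "2 * \<bar>u s * v s\<bar> \<le> ?N s"
      using sum_squares_bound [of "\<bar>u s\<bar>" "\<bar>v s\<bar>"] by (simp add: abs_mult)
    ultimately show "\<bar>2 * C * ?N s + 8 * (u s * v s)\<bar> \<le> (2 * \<bar>C\<bar> + 4) * ?N s" .
  qed (use assms in auto)
  then show "u t = 0" "v t = 0" by (auto simp: sum_power2_eq_zero_iff)
qed

section \<open>The determinant of the two pairs of coordinates\<close>

definition plane_det :: "real^5 \<Rightarrow> real" where
  "plane_det y = y$1 * y$5 - y$2 * y$4"

lemma pendulum_solution_component:
  assumes "pendulum_solution C D E F I y" "t \<in> I"
  shows "((\<lambda>s. y s $ i) has_real_derivative pendulum_field C D E F (y t) $ i) (at t within I)"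
  unfolding has_real_derivative_iff_has_vector_derivative
  by (rule bounded_linear.has_vector_derivative [OF bounded_linear_vec_nth])
    (use assms in \<open>auto simp: pendulum_solution_def\<close>)

text \<open>In the matrix with rows \<open>(y\<^sub>1, y\<^sub>2)\<close> and \<open>(y\<^sub>4, y\<^sub>5)\<close>, the bracketed term and the forcing act on
  the right by a trace-free matrix and the \<open>3/4\<close> term acts on the left by a rotation generator; neither
  changes the determinant, so only the damping \<open>C\<close>, acting on both rows, contributes.\<close>

lemma plane_det_derivative:
  assumes "pendulum_solution C D E F I y" "t \<in> I"
  shows "((\<lambda>s. plane_det (y s)) has_real_derivative 2 * C * plane_det (y t)) (at t within I)"
proof -
  note comp = pendulum_solution_component [OF assms]
  show ?thesis
    unfolding plane_det_def
    using DERIV_diff [OF DERIV_mult [OF comp [of 1] comp [of 5]] DERIV_mult [OF comp [of 2] comp [of 4]]]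
    by (rule DERIV_cong) (simp only: pendulum_field_def vector_5, simp only: algebra_simps)
qed

lemma plane_det_exp:
  assumes sol: "pendulum_solution C D E F I y" and "is_interval I" "0 \<in> I" "t \<in> I"
  shows "plane_det (y t) = plane_det (y 0) * exp (2 * C * t)"
proof -
  let ?g = "\<lambda>s. exp (- (2 * C) * s) * plane_det (y s)"
  have "(?g has_real_derivative 0) (at s within I)" if "s \<in> I" for s
    by (rule derivative_eq_intros plane_det_derivative [OF sol that] refl)+ (simp add: algebra_simps)
  then obtain c where "\<And>s. s \<in> I \<Longrightarrow> ?g s = c"
    using has_field_derivative_zero_constant [OF is_interval_convex [OF \<open>is_interval I\<close>], of ?g] by auto
  then have "?g t = ?g 0" using assms by metis
  then have "exp (2 * C * t) * ?g t = plane_det (y 0) * exp (2 * C * t)" by simp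
  moreover have "exp (2 * C * t) * ?g t = plane_det (y t)"
    by (simp add: mult.assoc [symmetric] exp_add [symmetric])
  ultimately show ?thesis by metis
qed

text \<open>The limit \<open>\<Delta>(p)\<close> of \<open>\<Delta>(0) exp (2 C s\<^sub>n)\<close> exists by continuity.  For \<open>C < 0\<close> it is 0 outright;
  for \<open>C > 0\<close>, multiplying back by the decaying \<open>exp (- 2 C s\<^sub>n)\<close> shows that \<open>\<Delta>(0) = 0\<close>.\<close>

lemma plane_det_limit_point:
  assumes "C \<noteq> 0" "pendulum_limit_set C D E F L" "p \<in> L"
  shows "plane_det p = 0"
proof -
  obtain x s where x: "pendulum_solution C D E F {0..} x"
    and s: "filterlim s at_top sequentially" and lim: "(\<lambda>n. x (s n)) \<longlonglongrightarrow> p"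
    using assms(2,3) unfolding pendulum_limit_set_def omega_limit_set_def by blast
  let ?d = "plane_det (x 0)"
  have "(\<lambda>n. plane_det (x (s n))) \<longlonglongrightarrow> plane_det p"
    unfolding plane_det_def by (intro tendsto_intros lim)
  moreover have "\<forall>\<^sub>F n in sequentially. plane_det (x (s n)) = ?d * exp (2 * C * s n)"
    using filterlim_at_top [THEN iffD1, OF s, rule_format, of 0]
    by eventually_elim (rule plane_det_exp [OF x], auto simp: is_interval_ci)
  ultimately have l: "(\<lambda>n. ?d * exp (2 * C * s n)) \<longlonglongrightarrow> plane_det p"
    by (rule Lim_transform_eventually)
  have decay: "(\<lambda>n. exp (c * s n)) \<longlonglongrightarrow> 0" if "c < 0" for c
    using that by (intro filterlim_compose [OF exp_at_bot]
        filterlim_tendsto_neg_mult_at_bot [OF tendsto_const _ s])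
  show ?thesis
  proof (cases "C < 0")
    case True
    then have "(\<lambda>n. ?d * exp (2 * C * s n)) \<longlonglongrightarrow> ?d * 0"
      by (intro tendsto_intros decay) simp
    then show ?thesis using LIMSEQ_unique [OF l] by simp
  next
    case False
    then have "(\<lambda>n. ?d * exp (2 * C * s n) * exp (- (2 * C) * s n)) \<longlonglongrightarrow> plane_det p * 0"
      using \<open>C \<noteq> 0\<close> by (intro tendsto_mult l decay) simp
    moreover have "?d * exp (2 * C * s n) * exp (- (2 * C) * s n) = ?d" for n
      by (simp add: mult.assoc exp_add [symmetric])
    ultimately have "(\<lambda>n. ?d) \<longlonglongrightarrow> 0" by (simp only: mult_zero_right)
    then have "?d = 0" by (simp add: LIMSEQ_const_iff)
    then show ?thesis using LIMSEQ_unique [OF l] by simp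
  qed
qed

section \<open>Reduction to third order\<close>

theorem mainTheorem3:
  fixes C D E F :: real
    and L :: "(real^5) set"
    and y0 :: "real^5"
    and I :: "real set"
    and y :: "real \<Rightarrow> real^5"
  assumes "C \<noteq> 0"
    and "pendulum_limit_set C D E F L"
    and "y0 \<in> L" and "y0$1 \<noteq> 0" and "y0$2 \<noteq> 0"
    and "is_interval I" and "0 \<in> I"
    and "pendulum_solution C D E F I y" and "y 0 = y0"
  shows "\<exists>K. K = y0$4 / y0$1 \<and> K = y0$5 / y0$2 \<and>
    (\<forall>t\<in>I.
      ((\<lambda>s. y s $ 1) has_real_derivative
        C * y t $ 1 - (y t $ 3 + 1/8 * (1 + K\<^sup>2) * ((y t $ 1)\<^sup>2 + (y t $ 2)\<^sup>2)) * y t $ 2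
          + 2 * y t $ 2) (at t within I) \<and>
      ((\<lambda>s. y s $ 2) has_real_derivative
        C * y t $ 2 + (y t $ 3 + 1/8 * (1 + K\<^sup>2) * ((y t $ 1)\<^sup>2 + (y t $ 2)\<^sup>2)) * y t $ 1
          + 2 * y t $ 1) (at t within I) \<and>
      ((\<lambda>s. y s $ 3) has_real_derivative
        D * (1 + K\<^sup>2) * y t $ 1 * y t $ 2 + E * y t $ 3 + F) (at t within I) \<and>
      y t $ 4 = K * y t $ 1 \<and>
      y t $ 5 = K * y t $ 2)"
proof -
  let ?K = "y0$4 / y0$1"
  let ?A = "\<lambda>s. y s $ 3 + 1/8 * ((y s $ 1)\<^sup>2 + (y s $ 2)\<^sup>2 + (y s $ 4)\<^sup>2 + (y s $ 5)\<^sup>2)"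
  have det0: "plane_det y0 = 0"
    using plane_det_limit_point assms(1-3) by blast
  then have K: "?K = y0$5 / y0$2"
    using assms(4,5) by (simp add: plane_det_def field_simps)
  note comp = pendulum_solution_component [OF assms(8)]
  have det: "y s $ 1 * y s $ 5 - y s $ 2 * y s $ 4 = 0" if "s \<in> I" for s
    using plane_det_exp [OF assms(8,6,7) that] det0 assms(9) by (simp add: plane_det_def)
  have d: "((\<lambda>s. y s $ 1) has_real_derivative C * y s $ 1 + (2 - ?A s) * y s $ 2) (at s within I)"
    "((\<lambda>s. y s $ 2) has_real_derivative C * y s $ 2 + (2 + ?A s) * y s $ 1) (at s within I)"
    "((\<lambda>s. y s $ 4) has_real_derivative C * y s $ 4 + (2 - ?A s) * y s $ 5) (at s within I)"
    "((\<lambda>s. y s $ 5) has_real_derivative C * y s $ 5 + (2 + ?A s) * y s $ 4) (at s within I)"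
    "((\<lambda>s. y s $ 3) has_real_derivative D * (y s $ 1 * y s $ 2 + y s $ 4 * y s $ 5) + E * y s $ 3 + F)
      (at s within I)"
    if "s \<in> I" for s
    using comp [OF that, of 1] comp [OF that, of 2] comp [OF that, of 4] comp [OF that, of 5]
      comp [OF that, of 3]
    unfolding pendulum_field_def vector_5 det [OF that] by (simp_all add: algebra_simps)
  have proportional: "y t $ 4 = ?K * y t $ 1 \<and> y t $ 5 = ?K * y t $ 2" if "t \<in> I" for t
  proof -
    let ?u = "\<lambda>s. y s $ 4 - ?K * y s $ 1" and ?v = "\<lambda>s. y s $ 5 - ?K * y s $ 2"
    have u: "(?u has_real_derivative C * ?u s + (2 - ?A s) * ?v s) (at s within I)" if "s \<in> I" for s
      using DERIV_diff [OF d(3) [OF that] DERIV_cmult [OF d(1) [OF that], of ?K]]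
      by (rule DERIV_cong) (simp add: algebra_simps)
    have v: "(?v has_real_derivative C * ?v s + (2 + ?A s) * ?u s) (at s within I)" if "s \<in> I" for s
      using DERIV_diff [OF d(4) [OF that] DERIV_cmult [OF d(2) [OF that], of ?K]]
      by (rule DERIV_cong) (simp add: algebra_simps)
    have "?u 0 = 0" using assms(4,9) by simp
    moreover have "?v 0 = 0" unfolding K using assms(5,9) by simp
    ultimately show ?thesis
      using linear_pair_zero [of I 0 t ?u C ?A ?v, OF assms(6,7) that u v] by simp
  qed
  have A: "?A t = y t $ 3 + 1/8 * (1 + ?K\<^sup>2) * ((y t $ 1)\<^sup>2 + (y t $ 2)\<^sup>2)" if "t \<in> I" for t
    using proportional [OF that] by (simp only: power_mult_distrib) (simp add: algebra_simps)
  show ?thesis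
  proof (intro exI [of _ ?K] conjI ballI)
    fix t assume t: "t \<in> I"
    show "((\<lambda>s. y s $ 1) has_real_derivative
        C * y t $ 1 - (y t $ 3 + 1/8 * (1 + ?K\<^sup>2) * ((y t $ 1)\<^sup>2 + (y t $ 2)\<^sup>2)) * y t $ 2
          + 2 * y t $ 2) (at t within I)"
      using d(1) [OF t] unfolding A [OF t] by (rule DERIV_cong) algebra
    show "((\<lambda>s. y s $ 2) has_real_derivative
        C * y t $ 2 + (y t $ 3 + 1/8 * (1 + ?K\<^sup>2) * ((y t $ 1)\<^sup>2 + (y t $ 2)\<^sup>2)) * y t $ 1
          + 2 * y t $ 1) (at t within I)"
      using d(2) [OF t] unfolding A [OF t] by (rule DERIV_cong) algebra
    show "((\<lambda>s. y s $ 3) has_real_derivative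
        D * (1 + ?K\<^sup>2) * y t $ 1 * y t $ 2 + E * y t $ 3 + F) (at t within I)"
      using d(5) [OF t] proportional [OF t]
      by (elim DERIV_cong) (simp add: power2_eq_square distrib_left distrib_right mult.assoc mult.left_commute)
  qed (use K proportional in auto)
qed

end
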